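(* Let $s \ge 2$, $t \ge 1$ and $b \ge 3$ be fixed integers, and let $\ell$ be the minimum integer such that $r_\ell(b) > s$. Then, as $n \to \infty$, $$f_{\alpha_s; K_b, \ldots, K_b}(n) \le n^{1/\left(\lfloor t/\ell \rfloor + 1\right) + o(1)},$$ where $K_b$ appears exactly $t$ times in the subscript on the left-hand side.
   Context: For a graph $G$, the $s$-independence number $\alpha_s(G)$ is the maximum size of a vertex subset that induces no copy of $K_s$. For integers $i_1,\ldots,i_t$, a graph $G$ is $(K_{i_1},\ldots,K_{i_t})$-free if there is a coloring of $E(G)$ with $t$ colors such that, for every $1 \le j \le t$, the edges of the $j$-th color contain no copy of $K_{i_j}$. The multicolor Erdős–Rogers function is $$f_{\alpha_s; K_{i_1},\ldots,K_{i_t}}(n) = \min\{\alpha_s(G) : G \text{ is a } (K_{i_1},\ldots,K_{i_t})\text{-free graph with } n \text{ vertices}\}.$$ The multicolor Ramsey number $r_\ell(b) = R(b,\ldots,b)$ ($\ell$ entries) is the smallest integer $m$ such that $K_m$ is not $(K_b,\ldots,K_b)$-free ($\ell$ entries), i.e. such that every coloring of $E(K_m)$ with $\ell$ colors contains a monochromatic $K_b$. With zero colors, $r_0(b)=2$, so $\ell \ge 1$ whenever $s\ge 2$. The term $o(1)$ tends to $0$ as $n\to\infty$ with $s,t,b$ fixed. *)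

theory Defs
  imports Complex_Main "HOL-Library.Ramsey"
begin

text \<open>
  A simple graph is a vertex set \<^term>\<open>V\<close> together with an edge set \<^prop>\<open>E \<subseteq> [V]\<^bsup>2\<^esup>\<close>
  of unordered pairs. The predicate \<^const>\<open>clique\<close> is the one of \<^theory>\<open>HOL-Library.Ramsey\<close>.
\<close>

definition contains_K :: "'a set \<Rightarrow> 'a set set \<Rightarrow> nat \<Rightarrow> bool" where
  "contains_K V E k \<longleftrightarrow> (\<exists>A \<in> [V]\<^bsup>k\<^esup>. clique A E)"

text \<open>
  Since \<^const>\<open>contains_K\<close> only looks at edges inside its vertex set, \<^term>\<open>contains_K A E s\<close>
  speaks about the subgraph induced on \<^term>\<open>A\<close>. For \<open>s \<ge> 1\<close> and finite \<open>V\<close> the maximum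
  is over a finite nonempty set, as the empty vertex set qualifies.
\<close>

definition indep_num :: "nat \<Rightarrow> 'a set \<Rightarrow> 'a set set \<Rightarrow> nat" where
  "indep_num s V E = Max {card A | A. A \<subseteq> V \<and> \<not> contains_K A E s}"

text \<open>
  The list \<^term>\<open>ks\<close> is \<open>(i\<^sub>1, \<dots>, i\<^sub>t)\<close>; colors are indexed from \<open>0\<close>. With the empty list there
  are no colors, so that only the edgeless graphs qualify.
\<close>

definition K_free :: "nat list \<Rightarrow> 'a set \<Rightarrow> 'a set set \<Rightarrow> bool" where
  "K_free ks V E \<longleftrightarrow>
     (\<exists>c \<in> E \<rightarrow> {..<length ks}. \<forall>j < length ks. \<not> contains_K V {e \<in> E. c e = j} (ks ! j))"

text \<open>
  Every graph on \<open>n\<close> vertices is isomorphic to one on \<^term>\<open>{..<n}\<close>. If all \<open>i\<^sub>j \<ge> 2\<close>, the minimum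
  is over a finite nonempty set, as the edgeless graph qualifies.
\<close>

definition erdos_rogers :: "nat \<Rightarrow> nat list \<Rightarrow> nat \<Rightarrow> nat" where
  "erdos_rogers s ks n =
     Min {indep_num s {..<n} E | E. E \<subseteq> [{..<n}]\<^bsup>2\<^esup> \<and> K_free ks {..<n} E}"

definition multicolor_ramsey :: "nat \<Rightarrow> nat \<Rightarrow> nat" where
  "multicolor_ramsey l b = (LEAST m. \<not> K_free (replicate l b) {..<m} ([{..<m}]\<^bsup>2\<^esup>))"

end

theory Submission
  imports Defs "HOL-Real_Asymp.Real_Asymp"
begin

text \<open>
  Consider points \<open>(x, z, u)\<close> of integer boxes and, for small \<open>i\<close>, the line through such a point
  labelled \<open>(i, x + i u, z + i |u|\<^sup>2)\<close>. Three pairwise collinear points not on a common line would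
  put a nontrivial affine relation between points \<open>(u, |u|\<^sup>2)\<close> of a paraboloid, so this linear
  space has no triangles. In dimension \<open>D\<close> it has \<open>n\<close> points, but only \<open>R \<le> n\<^bsup>1/2 + O(1/D)\<^esup>\<close> lines,
  while each point lies on \<open>r\<close> lines with \<open>r\<close> much larger than \<open>log n\<close>.

  Colour the points of every line at random with \<open>s\<close> labels, and give each pair of points on a line
  the colour of its pair of labels in an \<open>l\<close>-colouring of \<open>K\<^sub>s\<close> without monochromatic \<open>K\<^sub>b\<close>. As \<open>b \<ge> 3\<close>,
  a clique \<open>K\<^sub>b\<close> lives on one line, hence is not monochromatic. A set of \<open>R\<close> points in which every
  line misses a label has probability at most \<open>s\<^bsup>R\<^esup> (1 - 1/s)\<^bsup>r R\<^esup>\<close>, which beats the number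
  of sets. So some labelling yields a graph in which all sets of \<open>R\<close> points contain a \<open>K\<^sub>s\<close>.

  For \<open>k = \<lfloor>t / l\<rfloor>\<close>, pull this graph back along \<open>k\<close> independent random maps from \<open>N\<close> vertices to the
  points, with disjoint sets of colours, and take the union. A set of \<open>m\<close> vertices without \<open>K\<^sub>s\<close> has
  fewer than \<open>R\<close> image points under each map, which has probability about \<open>(R / n)\<^bsup>k m\<^esup>\<close>; for \<open>m\<close>
  slightly above \<open>R\<close> and \<open>N\<close> up to about \<open>m (n / R)\<^bsup>k\<^esup>\<close> no such set survives. With \<open>R\<close> close to the
  square root of \<open>n\<close> this gives the exponent \<open>1 / (k + 1)\<close>.
\<close>

subsection \<open>Random labellings of linear spaces without triangles\<close>

text \<open>Both probabilistic arguments are run by counting: \<open>\<Omega>\<close> is a finite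
  space of equally likely outcomes, and a common bound \<open>c\<close> on the size of the bad
  events is enough.\<close>

lemma union_bound:
  assumes "finite \<Omega>" "finite I"
    and "\<And>i. i \<in> I \<Longrightarrow> B i \<subseteq> \<Omega> \<and> card (B i) \<le> c"
    and "card I * c < card \<Omega>"
  obtains \<omega> where "\<omega> \<in> \<Omega>" "\<And>i. i \<in> I \<Longrightarrow> \<omega> \<notin> B i"
proof -
  have "card (\<Union>i\<in>I. B i) \<le> (\<Sum>i\<in>I. card (B i))"
    using \<open>finite I\<close> by (rule card_UN_le)
  also have "\<dots> \<le> card I * c"
    using assms(3) sum_bounded_above[of I "\<lambda>i. card (B i)" c] by simp
  finally have "card (\<Union>i\<in>I. B i) < card \<Omega>"
    using assms(4) by linarith
  then have "\<not> \<Omega> \<subseteq> (\<Union>i\<in>I. B i)"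
    using assms(1,3) by (metis (no_types, lifting) UN_least card_mono finite_subset not_le)
  then show ?thesis
    using that by auto
qed

lemma contains_K_mono:
  assumes "contains_K A E k" "A \<subseteq> B" "E \<subseteq> F"
  shows "contains_K B F k"
proof -
  obtain C where "C \<in> [A]\<^bsup>k\<^esup>" "clique C E"
    using assms(1) by (auto simp: contains_K_def)
  moreover from this have "C \<in> [B]\<^bsup>k\<^esup>" "clique C F"
    using assms(2,3) by (auto simp: nsets_def clique_def)
  ultimately show ?thesis
    by (auto simp: contains_K_def)
qed

text \<open>Gives the size of a bad event in both random constructions: the coordinates in
  \<open>T\<close> have a restricted range of size \<open>x\<close>, the others the full range of
  size \<open>y\<close>.\<close>

lemma prod_if_subset:
  fixes x y :: nat
  assumes "finite S" "T \<subseteq> S"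
  shows "(\<Prod>a\<in>S. if a \<in> T then x else y) = x ^ card T * y ^ (card S - card T)"
proof -
  have "S \<inter> {a. a \<in> T} = T" "S \<inter> - {a. a \<in> T} = S - T"
    using assms by auto
  then show ?thesis
    using assms by (simp add: prod.If_cases card_Diff_subset finite_subset)
qed

text \<open>
  The events of the union bound are indexed by a set \<open>A\<close> of points together with a choice of one
  missing label for every line.
\<close>

lemma exists_rainbow_colouring:
  fixes lines :: "'p \<Rightarrow> 'q set"
  assumes "finite P" "finite B" "B \<noteq> {}" "s > 0"
    and lines: "\<And>x. x \<in> P \<Longrightarrow> lines x \<subseteq> B \<and> card (lines x) = r"
    and small: "card P * s * (s - 1) ^ r < s ^ r"
  shows "\<exists>\<phi> :: 'q \<Rightarrow> 'p \<Rightarrow> nat. (\<forall>L\<in>B. \<forall>x\<in>P. \<phi> L x < s) \<and>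
    (\<forall>A\<subseteq>P. card B \<le> card A \<longrightarrow> (\<exists>L\<in>B. {..<s} \<subseteq> \<phi> L ` {x \<in> A. L \<in> lines x}))"
proof -
  define \<Omega> where "\<Omega> = (B \<times> P) \<rightarrow>\<^sub>E {..<s}"
  define R where "R = card B"
  define I where "I = [P]\<^bsup>R\<^esup> \<times> (B \<rightarrow>\<^sub>E {..<s})"
  define inc where "inc A = {(L, x). L \<in> B \<and> x \<in> A \<and> L \<in> lines x}" for A
  define bad where "bad = (\<lambda>(A, g). Pi\<^sub>E (B \<times> P)
    (\<lambda>a. if a \<in> inc A then {..<s} - {g (fst a)} else {..<s}))"
  \<comment> \<open>At each of the \<open>R * r\<close> incidences between \<open>A\<close> and the
    lines, the label must avoid the one declared missing, which leaves \<open>s - 1\<close>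
    choices.\<close>
  define c where "c = (s - 1) ^ (R * r) * s ^ (R * card P - R * r)"
  have "R > 0"
    using assms by (simp add: R_def card_gt_0_iff)
  have "finite \<Omega>" "finite I"
    using assms by (auto simp: \<Omega>_def I_def intro!: finite_PiE finite_imp_finite_nsets)
  have sub: "inc A \<subseteq> B \<times> P" "card (inc A) = R * r" if "A \<in> [P]\<^bsup>R\<^esup>" for A
  proof -
    have A: "A \<subseteq> P" "finite A" "card A = R"
      using that by (auto simp: nsets_def)
    then show "inc A \<subseteq> B \<times> P"
      by (auto simp: inc_def)
    \<comment> \<open>Incidences are counted point by point, since every point lies on exactly
      \<open>r\<close> lines.\<close>
    have "inc A = (\<lambda>(x, L). (L, x)) ` (SIGMA x:A. lines x)"
      using A lines by (fastforce simp: inc_def image_iff)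
    also have "card \<dots> = card (SIGMA x:A. lines x)"
      by (rule card_image) (auto simp: inj_on_def)
    also have "\<dots> = (\<Sum>x\<in>A. card (lines x))"
      using A lines \<open>finite B\<close> by (intro card_SigmaI) (auto dest: finite_subset[OF _ \<open>finite B\<close>])
    also have "\<dots> = R * r"
      using A lines by (simp add: subset_iff)
    finally show "card (inc A) = R * r" .
  qed
  have bad_le: "bad i \<subseteq> \<Omega> \<and> card (bad i) \<le> c" if "i \<in> I" for i
  proof -
    obtain A g where i: "i = (A, g)" "A \<in> [P]\<^bsup>R\<^esup>" "g \<in> B \<rightarrow>\<^sub>E {..<s}"
      using \<open>i \<in> I\<close> by (auto simp: I_def)
    have "bad i \<subseteq> \<Omega>"
      unfolding bad_def \<Omega>_def i(1) prod.case by (intro PiE_mono) auto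
    moreover have "card (bad i) = (\<Prod>a\<in>B \<times> P. if a \<in> inc A then s - 1 else s)"
      unfolding bad_def i(1) prod.case
      using assms(1,2) i(3) by (subst card_PiE) (auto intro!: prod.cong simp: inc_def PiE_iff)
    moreover have "\<dots> = c"
      using assms(1,2) sub[OF i(2)] by (simp add: prod_if_subset c_def R_def)
    ultimately show ?thesis by simp
  qed
  obtain \<phi> where \<phi>: "\<phi> \<in> \<Omega>" "\<And>i. i \<in> I \<Longrightarrow> \<phi> \<notin> bad i"
  proof (cases "R \<le> card P")
    case True
    have "r \<le> card B"
    proof -
      obtain x where "x \<in> P"
        using True \<open>R > 0\<close> assms(1) by fastforce
      then show ?thesis
        using lines[of x] \<open>finite B\<close> by (metis card_mono)
    qed
    then have le: "R * r \<le> R * card P"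
      using True by (simp add: R_def)
    have "card I \<le> (card P * s) ^ R"
    proof -
      have "card I = (card P choose R) * s ^ R"
        using assms(2) by (simp add: I_def card_cartesian_product card_PiE R_def)
      also have "\<dots> \<le> card P ^ R * s ^ R"
        using True by (intro mult_le_mono1 binomial_le_pow)
      finally show ?thesis
        by (simp only: power_mult_distrib)
    qed
    \<comment> \<open>The union bound is the \<open>R\<close>-th power of the hypothesis
      \<open>small\<close>.\<close>
    then have "card I * c \<le> (card P * s) ^ R * c"
      by simp
    also have "\<dots> = (card P * s * (s - 1) ^ r) ^ R * s ^ (R * card P - R * r)"
      by (simp add: c_def power_mult_distrib power_mult mult.commute[of R r] mult.assoc)
    also have "\<dots> < (s ^ r) ^ R * s ^ (R * card P - R * r)"
      using small \<open>R > 0\<close> \<open>s > 0\<close> by (intro mult_strict_right_mono power_strict_mono) auto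
    also have "\<dots> = s ^ (R * card P)"
      using le by (metis power_mult power_add mult.commute le_add_diff_inverse)
    also have "\<dots> = card \<Omega>"
      using assms(1,2) by (simp add: \<Omega>_def card_PiE R_def)
    finally have "card I * c < card \<Omega>" .
    from union_bound[where B = bad, OF \<open>finite \<Omega>\<close> \<open>finite I\<close> bad_le this] that
    show ?thesis by metis
  next
    case False
    \<comment> \<open>With fewer than \<open>R\<close> points there are no events to avoid, and any
      labelling works.\<close>
    then have "I = {}"
      using assms(1) by (simp add: I_def nsets_eq_empty)
    moreover have "\<Omega> \<noteq> {}"
      using \<open>s > 0\<close> by (auto simp: \<Omega>_def PiE_eq_empty_iff)
    ultimately show ?thesis
      using that by auto
  qed
  show ?thesis
  proof (intro exI[of _ "\<lambda>L x. \<phi> (L, x)"] conjI allI impI)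
    fix A assume A: "A \<subseteq> P" "card B \<le> card A"
    then obtain A' where A': "A' \<subseteq> A" "card A' = R" "finite A'"
      unfolding R_def using obtain_subset_with_card_n[OF A(2)] by metis
    show "\<exists>L\<in>B. {..<s} \<subseteq> (\<lambda>x. \<phi> (L, x)) ` {x \<in> A. L \<in> lines x}"
    proof (rule ccontr)
      assume *: "\<not> ?thesis"
      \<comment> \<open>If no line sees all labels on \<open>A\<close>, then choosing a missing
        label for each line exhibits \<open>\<phi>\<close> as a member of a bad event.\<close>
      define g where "g = restrict (\<lambda>L. SOME y. y < s \<and> (\<forall>x\<in>A. L \<in> lines x \<longrightarrow> \<phi> (L, x) \<noteq> y)) B"
      have g: "g L < s \<and> (\<forall>x\<in>A. L \<in> lines x \<longrightarrow> \<phi> (L, x) \<noteq> g L)" if "L \<in> B" for L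
      proof -
        have "\<exists>y. y < s \<and> (\<forall>x\<in>A. L \<in> lines x \<longrightarrow> \<phi> (L, x) \<noteq> y)"
        proof -
          have "\<not> {..<s} \<subseteq> (\<lambda>x. \<phi> (L, x)) ` {x \<in> A. L \<in> lines x}"
            using * that by blast
          then obtain y where "y < s" "y \<notin> (\<lambda>x. \<phi> (L, x)) ` {x \<in> A. L \<in> lines x}"
            by blast
          then show ?thesis by blast
        qed
        from someI_ex[OF this] that show ?thesis
          by (simp add: g_def)
      qed
      have "(A', g) \<in> I"
        using g A A' by (auto simp: I_def nsets_def g_def)
      moreover have "\<phi> \<in> bad (A', g)"
        unfolding bad_def prod.case
      proof (rule PiE_I)
        fix a assume "a \<in> B \<times> P"
        then show "\<phi> a \<in> (if a \<in> inc A' then {..<s} - {g (fst a)} else {..<s})"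
          using \<phi>(1) g A' by (auto simp: \<Omega>_def inc_def PiE_iff)
      qed (use \<phi>(1) in \<open>auto simp: \<Omega>_def\<close>)
      ultimately show False
        using \<phi>(2) by blast
    qed
  qed (use \<phi>(1) in \<open>auto simp: \<Omega>_def\<close>)
qed

text \<open>Two points on a line are joined when their labels there differ, in the colour that
  \<open>free\<close> gives to the pair of labels. By \<open>triangle\<close>, a clique of at least
  three points lies on one line; if it is monochromatic, its labels form a monochromatic clique of
  the same size in the complete graph on \<open>{..<s}\<close>. A line that shows all labels on
  \<open>A\<close> yields the copy of \<open>K_s\<close>.\<close>

lemma exists_layer:
  fixes lines :: "'p \<Rightarrow> 'q set"
  assumes "finite P" "finite B" "B \<noteq> {}" "s > 0"
    and lines: "\<And>x. x \<in> P \<Longrightarrow> lines x \<subseteq> B \<and> card (lines x) = r"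
    and linear: "\<And>x y L M. x \<in> P \<Longrightarrow> y \<in> P \<Longrightarrow> x \<noteq> y \<Longrightarrow>
      L \<in> lines x \<Longrightarrow> L \<in> lines y \<Longrightarrow> M \<in> lines x \<Longrightarrow> M \<in> lines y \<Longrightarrow> L = M"
    and triangle: "\<And>x y z L M N. x \<in> P \<Longrightarrow> y \<in> P \<Longrightarrow> z \<in> P \<Longrightarrow> x \<noteq> y \<Longrightarrow> y \<noteq> z \<Longrightarrow> x \<noteq> z \<Longrightarrow>
      L \<in> lines x \<Longrightarrow> L \<in> lines y \<Longrightarrow> M \<in> lines y \<Longrightarrow> M \<in> lines z \<Longrightarrow>
      N \<in> lines z \<Longrightarrow> N \<in> lines x \<Longrightarrow> L = M"
    and small: "card P * s * (s - 1) ^ r < s ^ r"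
    and "b \<ge> 3"
    and free: "K_free (replicate l b) {..<s} ([{..<s}]\<^bsup>2\<^esup>)"
  shows "\<exists>F :: nat \<Rightarrow> 'p set set. (\<forall>h. F h \<subseteq> [P]\<^bsup>2\<^esup>) \<and>
    (\<forall>h<l. \<not> contains_K P (F h) b) \<and>
    (\<forall>A\<subseteq>P. card B \<le> card A \<longrightarrow> contains_K A (\<Union>h<l. F h) s)"
proof -
  have "\<exists>\<phi> :: 'q \<Rightarrow> 'p \<Rightarrow> nat. (\<forall>L\<in>B. \<forall>x\<in>P. \<phi> L x < s) \<and>
    (\<forall>A\<subseteq>P. card B \<le> card A \<longrightarrow> (\<exists>L\<in>B. {..<s} \<subseteq> \<phi> L ` {x \<in> A. L \<in> lines x}))"
    using assms(1-4) lines small by (rule exists_rainbow_colouring)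
  then obtain \<phi> :: "'q \<Rightarrow> 'p \<Rightarrow> nat"
    where \<phi>: "\<And>L x. L \<in> B \<Longrightarrow> x \<in> P \<Longrightarrow> \<phi> L x < s"
    and rainbow: "\<And>A. A \<subseteq> P \<Longrightarrow> card B \<le> card A \<Longrightarrow>
           \<exists>L\<in>B. {..<s} \<subseteq> \<phi> L ` {x \<in> A. L \<in> lines x}"
    by metis
  obtain c where c: "c \<in> [{..<s}]\<^bsup>2\<^esup> \<rightarrow> {..<l}"
    and c_free: "\<And>h. h < l \<Longrightarrow> \<not> contains_K {..<s} {e \<in> [{..<s}]\<^bsup>2\<^esup>. c e = h} b"
    using free by (auto simp: K_free_def)
  define F where "F h = {{x, y} | x y L. x \<in> P \<and> y \<in> P \<and> L \<in> lines x \<and> L \<in> lines y \<and>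
    \<phi> L x \<noteq> \<phi> L y \<and> c {\<phi> L x, \<phi> L y} = h}" for h
  show ?thesis
  proof (intro exI[of _ F] conjI allI impI)
    show "F h \<subseteq> [P]\<^bsup>2\<^esup>" for h
      by (auto simp: F_def)
  next
    fix h assume "h < l"
    show "\<not> contains_K P (F h) b"
    proof
      assume "contains_K P (F h) b"
      then obtain A where A: "A \<subseteq> P" "finite A" "card A = b" "clique A (F h)"
        by (auto simp: contains_K_def nsets_def)
      have line: "\<exists>L. L \<in> lines x \<and> L \<in> lines y \<and> \<phi> L x \<noteq> \<phi> L y \<and> c {\<phi> L x, \<phi> L y} = h"
        if "x \<in> A" "y \<in> A" "x \<noteq> y" for x y
      proof -
        have "{x, y} \<in> F h"
          using A(4) that by (auto simp: clique_def)
        then obtain x' y' L where *: "{x, y} = {x', y'}" "L \<in> lines x'" "L \<in> lines y'"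
          "\<phi> L x' \<noteq> \<phi> L y'" "c {\<phi> L x', \<phi> L y'} = h"
          by (auto simp: F_def)
        from *(1) consider "x = x'" "y = y'" | "x = y'" "y = x'"
          by (auto simp: doubleton_eq_iff)
        then show ?thesis
          by cases (use * in \<open>auto simp: insert_commute\<close>)
      qed
      obtain x where "x \<in> A"
        using A \<open>b \<ge> 3\<close> by fastforce
      have "\<not> A \<subseteq> {x}"
        using A(3) \<open>b \<ge> 3\<close> card_mono[of "{x}" A] by auto
      then obtain y where "y \<in> A" "x \<noteq> y"
        by blast
      obtain L where L: "L \<in> lines x" "L \<in> lines y"
        using line[OF \<open>x \<in> A\<close> \<open>y \<in> A\<close> \<open>x \<noteq> y\<close>] by blast
      \<comment> \<open>The line through the first two clique points contains every further one, as
        the three would otherwise span a triangle.\<close>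
      have all: "L \<in> lines z" if "z \<in> A" for z
      proof (cases "z = x \<or> z = y")
        case False
        obtain M N where "M \<in> lines y" "M \<in> lines z" "N \<in> lines z" "N \<in> lines x"
          using line[OF \<open>y \<in> A\<close> \<open>z \<in> A\<close>] line[OF \<open>z \<in> A\<close> \<open>x \<in> A\<close>] False by blast
        then show ?thesis
          using triangle[of x y z L M N] L A(1) \<open>x \<in> A\<close> \<open>y \<in> A\<close> \<open>z \<in> A\<close> \<open>x \<noteq> y\<close> False by blast
      qed (use L in auto)
      \<comment> \<open>The line that produced an edge need not be \<open>L\<close> a priori;
        \<open>linear\<close> identifies it with \<open>L\<close>.\<close>
      have L_edge: "\<phi> L u \<noteq> \<phi> L v \<and> c {\<phi> L u, \<phi> L v} = h" if uv: "u \<in> A" "v \<in> A" "u \<noteq> v" for u v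
      proof -
        obtain M where M: "M \<in> lines u" "M \<in> lines v" "\<phi> M u \<noteq> \<phi> M v" "c {\<phi> M u, \<phi> M v} = h"
          using line[OF uv] by blast
        then have "M = L"
          using linear[of u v M L] all uv A(1) by blast
        then show ?thesis
          using M by simp
      qed
      have "L \<in> B"
        using L(1) lines A(1) \<open>x \<in> A\<close> by blast
      then have img: "\<phi> L ` A \<in> [{..<s}]\<^bsup>b\<^esup>"
        using A \<phi> card_image[of "\<phi> L" A] L_edge by (fastforce simp: nsets_def inj_on_def)
      have "clique (\<phi> L ` A) {e \<in> [{..<s}]\<^bsup>2\<^esup>. c e = h}"
        unfolding clique_def
      proof (intro ballI impI)
        fix p q assume pq: "p \<in> \<phi> L ` A" "q \<in> \<phi> L ` A" "p \<noteq> q"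
        then obtain u v where "u \<in> A" "v \<in> A" "p = \<phi> L u" "q = \<phi> L v"
          by blast
        moreover have "p < s" "q < s"
          using pq img by (auto simp: nsets_def)
        ultimately show "{p, q} \<in> {e \<in> [{..<s}]\<^bsup>2\<^esup>. c e = h}"
          using L_edge[of u v] pq(3) by auto
      qed
      then show False
        using c_free[OF \<open>h < l\<close>] img by (auto simp: contains_K_def)
    qed
  next
    fix A assume A: "A \<subseteq> P" "card B \<le> card A"
    then obtain L where L: "L \<in> B" "{..<s} \<subseteq> \<phi> L ` {x \<in> A. L \<in> lines x}"
      using rainbow by blast
    \<comment> \<open>One point is kept for each label, so the labels on \<open>T\<close> are
      distinct.\<close>
    then obtain T where T: "T \<subseteq> {x \<in> A. L \<in> lines x}" "inj_on (\<phi> L) T" "\<phi> L ` T = {..<s}"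
      unfolding subset_image_inj by metis
    have cardT: "card T = s"
      using card_image[OF T(2)] T(3) by simp
    have "finite T"
      using T(2,3) finite_image_iff by fastforce
    then have "T \<in> [A]\<^bsup>s\<^esup>"
      using T(1) cardT by (auto simp: nsets_def)
    moreover have "clique T (\<Union>h<l. F h)"
      unfolding clique_def
    proof (intro ballI impI)
      fix u v assume uv: "u \<in> T" "v \<in> T" "u \<noteq> v"
      then have ne: "\<phi> L u \<noteq> \<phi> L v"
        using T(2) by (auto simp: inj_on_def)
      have "\<phi> L u < s" "\<phi> L v < s"
        using uv T(3) by auto
      then have "c {\<phi> L u, \<phi> L v} < l"
        using c ne by (auto simp: Pi_iff)
      moreover have "{u, v} \<in> F (c {\<phi> L u, \<phi> L v})"
        unfolding F_def using uv T(1) A(1) ne by blast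
      ultimately show "{u, v} \<in> (\<Union>h<l. F h)"
        by auto
    qed
    ultimately show "contains_K A (\<Union>h<l. F h) s"
      by (auto simp: contains_K_def)
  qed
qed

subsection \<open>Unions of random blow-ups\<close>

text \<open>The sets \<open>F i\<close> may overlap: each edge takes one index whose set contains
  it. Colours from \<open>t'\<close> on stay empty, and an empty class has no clique on
  \<open>b \<ge> 2\<close> vertices.\<close>

lemma K_free_cover:
  assumes "E \<subseteq> (\<Union>i<t'. F i)" "\<And>i. i < t' \<Longrightarrow> \<not> contains_K V (F i) b" "t' \<le> t" "b \<ge> 2"
  shows "K_free (replicate t b) V E"
proof -
  have "\<forall>e\<in>E. \<exists>i<t'. e \<in> F i"
    using assms(1) by auto
  then obtain c where c: "\<And>e. e \<in> E \<Longrightarrow> c e < t' \<and> e \<in> F (c e)"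
    by metis
  have "\<not> contains_K V {e \<in> E. c e = j} b" if "j < t" for j
  proof (cases "j < t'")
    case True
    have "{e \<in> E. c e = j} \<subseteq> F j"
      using c by auto
    then show ?thesis
      using assms(2)[OF True] contains_K_mono by blast
  next
    case False
    then have "{e \<in> E. c e = j} = {}"
      using c by blast
    moreover have "\<not> contains_K V {} b"
    proof
      assume "contains_K V {} b"
      then obtain A where "card A = b" "clique A ({} :: 'a set set)" "finite A"
        by (auto simp: contains_K_def nsets_def)
      then have "card A \<le> Suc 0"
        by (auto simp: card_le_Suc0_iff_eq clique_def)
      then show False
        using \<open>card A = b\<close> \<open>b \<ge> 2\<close> by simp
    qed
    ultimately show ?thesis by metis
  qed
  moreover have "c \<in> E \<rightarrow> {..<t}"
    using c assms(3) by fastforce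
  ultimately show ?thesis
    unfolding K_free_def by (intro bexI[of _ c]) auto
qed

text \<open>Vertices with the same image are never adjacent, since \<open>F\<close> has no loops. So
  \<open>f\<close> is injective on a clique and carries it to a clique of the same size.\<close>

lemma pullback_no_K:
  assumes "F \<subseteq> [P]\<^bsup>2\<^esup>" "f ` V \<subseteq> P" "\<not> contains_K P F b"
  shows "\<not> contains_K V {e \<in> [V]\<^bsup>2\<^esup>. f ` e \<in> F} b"
proof
  assume "contains_K V {e \<in> [V]\<^bsup>2\<^esup>. f ` e \<in> F} b"
  then obtain A where A: "A \<in> [V]\<^bsup>b\<^esup>" "clique A {e \<in> [V]\<^bsup>2\<^esup>. f ` e \<in> F}"
    by (auto simp: contains_K_def)
  have edge: "{f u, f v} \<in> F" if "u \<in> A" "v \<in> A" "u \<noteq> v" for u v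
    using A(2) that by (auto simp: clique_def)
  have "f u \<noteq> f v" if "u \<in> A" "v \<in> A" "u \<noteq> v" for u v
    using subsetD[OF assms(1) edge[OF that]] by simp
  then have "inj_on f A"
    unfolding inj_on_def by blast
  then have "f ` A \<in> [P]\<^bsup>b\<^esup>"
    using A(1) assms(2) by (auto simp: nsets_def card_image)
  moreover have "clique (f ` A) F"
    using edge by (auto simp: clique_def)
  ultimately show False
    using assms(3) by (auto simp: contains_K_def)
qed

text \<open>Choosing one preimage for each vertex of the clique lifts it.\<close>

lemma pullback_K:
  assumes "F \<subseteq> [P]\<^bsup>2\<^esup>" "A \<subseteq> V" "contains_K (f ` A) F s"
  shows "contains_K A {e \<in> [V]\<^bsup>2\<^esup>. f ` e \<in> F} s"
proof -
  obtain T where T: "T \<subseteq> f ` A" "finite T" "card T = s" "clique T F"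
    using assms(3) by (auto simp: contains_K_def nsets_def)
  from T(1) obtain T' where T': "T' \<subseteq> A" "inj_on f T'" "f ` T' = T"
    unfolding subset_image_inj by metis
  have "T' \<in> [A]\<^bsup>s\<^esup>"
    using T T' by (auto simp: nsets_def card_image finite_image_iff)
  moreover have "clique T' {e \<in> [V]\<^bsup>2\<^esup>. f ` e \<in> F}"
    unfolding clique_def
  proof (intro ballI impI)
    fix u v assume uv: "u \<in> T'" "v \<in> T'" "u \<noteq> v"
    then have "f u \<in> T" "f v \<in> T" "f u \<noteq> f v"
      using T'(2,3) by (auto dest: inj_onD)
    then have "{f u, f v} \<in> F"
      using T(4) unfolding clique_def by blast
    then show "{u, v} \<in> {e \<in> [V]\<^bsup>2\<^esup>. f ` e \<in> F}"
      using uv T'(1) assms(2) by auto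
  qed
  ultimately show ?thesis
    by (auto simp: contains_K_def)
qed

text \<open>A random map is bad on an \<open>m\<close>-set if it sends it into some
  \<open>a\<close>-set. The hypothesis \<open>small\<close> is the union bound over the
  \<open>m\<close>-set and one \<open>a\<close>-set for each of the \<open>k\<close> independent
  maps, with \<open>card P ^ a\<close> bounding the number of \<open>a\<close>-sets. On any
  \<open>m\<close>-set some map then has at least \<open>a\<close> images, and \<open>dense\<close>
  applies to them.\<close>

lemma exists_blowup_union:
  fixes F :: "nat \<Rightarrow> 'p set set" and k N m a s b t :: nat
  assumes "finite P" "a \<le> card P" "k > 0" "b \<ge> 2" "k * l \<le> t"
    and F: "\<And>h. F h \<subseteq> [P]\<^bsup>2\<^esup>" "\<And>h. h < l \<Longrightarrow> \<not> contains_K P (F h) b"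
    and dense: "\<And>A. A \<subseteq> P \<Longrightarrow> a \<le> card A \<Longrightarrow> contains_K A (\<Union>h<l. F h) s"
    and small: "(N choose m) * (card P ^ a * a ^ m) ^ k < card P ^ (m * k)"
  shows "\<exists>E. E \<subseteq> [{..<N}]\<^bsup>2\<^esup> \<and> K_free (replicate t b) {..<N} E \<and>
    (\<forall>A\<subseteq>{..<N}. m \<le> card A \<longrightarrow> contains_K A E s)"
proof -
  define \<Omega> where "\<Omega> = ({..<k} \<times> {..<N}) \<rightarrow>\<^sub>E P"
  define I where "I = [{..<N}]\<^bsup>m\<^esup> \<times> ({..<k} \<rightarrow>\<^sub>E [P]\<^bsup>a\<^esup>)"
  define bad where "bad = (\<lambda>(A, S). Pi\<^sub>E ({..<k} \<times> {..<N})
    (\<lambda>p. if p \<in> {..<k} \<times> A then S (fst p) else P))"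
  define c where "c = a ^ (k * m) * card P ^ (k * N - k * m)"
  have "finite \<Omega>" "finite I"
    using assms(1) by (auto simp: \<Omega>_def I_def intro!: finite_PiE finite_imp_finite_nsets)
  have bad_le: "bad i \<subseteq> \<Omega> \<and> card (bad i) \<le> c" if "i \<in> I" for i
  proof -
    obtain A S where i: "i = (A, S)" "A \<in> [{..<N}]\<^bsup>m\<^esup>" "S \<in> {..<k} \<rightarrow>\<^sub>E [P]\<^bsup>a\<^esup>"
      using \<open>i \<in> I\<close> by (auto simp: I_def)
    have S: "S j \<subseteq> P \<and> card (S j) = a" if "j < k" for j
      using i(3) that by (auto simp: PiE_iff nsets_def)
    have A: "A \<subseteq> {..<N}" "card A = m"
      using i(2) by (auto simp: nsets_def)
    have "(if p \<in> {..<k} \<times> A then S (fst p) else P) \<subseteq> P" if "p \<in> {..<k} \<times> {..<N}" for p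
      using S[of "fst p"] that by auto
    then have "bad i \<subseteq> \<Omega>"
      unfolding bad_def \<Omega>_def i(1) prod.case by (rule PiE_mono)
    moreover have "card (bad i) = (\<Prod>p\<in>{..<k} \<times> {..<N}. if p \<in> {..<k} \<times> A then a else card P)"
      unfolding bad_def i(1) prod.case
      using S by (subst card_PiE) (auto intro!: prod.cong)
    moreover have "\<dots> = a ^ card ({..<k} \<times> A) * card P ^ (card ({..<k} \<times> {..<N}) - card ({..<k} \<times> A))"
      using A by (intro prod_if_subset) auto
    ultimately show ?thesis
      using A by (simp add: c_def card_cartesian_product)
  qed
  \<comment> \<open>For empty \<open>P\<close> also \<open>a = 0\<close>, and \<open>small\<close>
    fails both for \<open>m = 0\<close> and for \<open>m > 0\<close>.\<close>
  have "card P > 0"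
    using small by (cases "card P = 0") (use \<open>a \<le> card P\<close> \<open>k > 0\<close> in \<open>auto simp: zero_power power_0_left split: if_splits\<close>)
  obtain f where f: "f \<in> \<Omega>" "\<And>i. i \<in> I \<Longrightarrow> f \<notin> bad i"
  proof (cases "m \<le> N")
    case True
    have "card I * c \<le> (N choose m) * (card P ^ a) ^ k * c"
      using assms(1,2)
      by (auto simp: I_def card_cartesian_product card_PiE intro!: mult_right_mono mult_left_mono power_mono binomial_le_pow)
    also have "\<dots> = (N choose m) * (card P ^ a * a ^ m) ^ k * card P ^ (k * N - k * m)"
      by (simp add: c_def power_mult_distrib mult.commute[of k m] power_mult mult.assoc)
    also have "\<dots> < card P ^ (m * k) * card P ^ (k * N - k * m)"
      using small \<open>card P > 0\<close> by (intro mult_strict_right_mono) auto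
    also have "\<dots> = card P ^ (k * N)"
      using True by (metis power_add mult.commute le_add_diff_inverse mult_le_mono2)
    also have "\<dots> = card \<Omega>"
      by (simp add: \<Omega>_def card_PiE card_cartesian_product)
    finally have "card I * c < card \<Omega>" .
    from union_bound[where B = bad, OF \<open>finite \<Omega>\<close> \<open>finite I\<close> bad_le this] that
    show ?thesis by metis
  next
    case False
    then have "I = {}"
      by (simp add: I_def nsets_eq_empty)
    moreover have "\<Omega> \<noteq> {}"
      using \<open>card P > 0\<close> by (auto simp: \<Omega>_def PiE_eq_empty_iff)
    ultimately show ?thesis
      using that by auto
  qed
  \<comment> \<open>The index \<open>i\<close> encodes a pair: the map \<open>i div l\<close> and
    the colour \<open>i mod l\<close> of the layer.\<close>
  define G where "G i = {e \<in> [{..<N}]\<^bsup>2\<^esup>. (\<lambda>x. f (i div l, x)) ` e \<in> F (i mod l)}" for i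
  have fP: "(\<lambda>x. f (j, x)) ` {..<N} \<subseteq> P" if "j < k" for j
    using f(1) that by (auto simp: \<Omega>_def PiE_iff)
  show ?thesis
  proof (intro exI[of _ "\<Union>i<k * l. G i"] conjI allI impI)
    show "(\<Union>i<k * l. G i) \<subseteq> [{..<N}]\<^bsup>2\<^esup>"
      by (auto simp: G_def)
    show "K_free (replicate t b) {..<N} (\<Union>i<k * l. G i)"
    proof (rule K_free_cover[OF subset_refl _ \<open>k * l \<le> t\<close> \<open>b \<ge> 2\<close>])
      fix i assume "i < k * l"
      then have "i div l < k" "i mod l < l"
        by (auto simp: less_mult_imp_div_less intro!: mod_less_divisor gr0I)
      then show "\<not> contains_K {..<N} (G i) b"
        unfolding G_def by (intro pullback_no_K[OF F(1) fP F(2)])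
    qed
  next
    fix A assume A: "A \<subseteq> {..<N}" "m \<le> card A"
    then obtain A' where A': "A' \<subseteq> A" "card A' = m" "finite A'"
      using obtain_subset_with_card_n[OF A(2)] by metis
    have "\<exists>j<k. a \<le> card ((\<lambda>x. f (j, x)) ` A')"
    proof (rule ccontr)
      assume *: "\<not> ?thesis"
      have "\<exists>S\<in>[P]\<^bsup>a\<^esup>. (\<lambda>x. f (j, x)) ` A' \<subseteq> S" if "j < k" for j
      proof -
        have "(\<lambda>x. f (j, x)) ` A' \<subseteq> P" "card ((\<lambda>x. f (j, x)) ` A') \<le> a"
          using fP[OF that] A' A * that by force+
        \<comment> \<open>Each small image is padded to exactly \<open>a\<close> points, to match
          the index set of the events.\<close>
        then obtain S where "(\<lambda>x. f (j, x)) ` A' \<subseteq> S" "S \<subseteq> P" "card S = a"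
          using exists_subset_between[of "(\<lambda>x. f (j, x)) ` A'" a P] assms(1,2) by metis
        then show ?thesis
          using finite_subset[OF _ assms(1)] by (auto simp: nsets_def)
      qed
      then obtain S where S: "\<And>j. j < k \<Longrightarrow> S j \<in> [P]\<^bsup>a\<^esup> \<and> (\<lambda>x. f (j, x)) ` A' \<subseteq> S j"
        by metis
      have "(A', restrict S {..<k}) \<in> I"
        using A A' S by (auto simp: I_def nsets_def)
      moreover have "f \<in> bad (A', restrict S {..<k})"
        using f(1) S unfolding bad_def \<Omega>_def prod.case by (auto simp: PiE_iff)
      ultimately show False
        using f(2) by blast
    qed
    then obtain j where j: "j < k" "a \<le> card ((\<lambda>x. f (j, x)) ` A')"
      by blast
    then have "contains_K ((\<lambda>x. f (j, x)) ` A') (\<Union>h<l. F h) s"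
      using dense fP[OF j(1)] A A' by (meson image_mono order_trans)
    then have "contains_K A' {e \<in> [{..<N}]\<^bsup>2\<^esup>. (\<lambda>x. f (j, x)) ` e \<in> (\<Union>h<l. F h)} s"
      using A A' F(1) by (intro pullback_K[where P = P]) auto
    moreover have "{e \<in> [{..<N}]\<^bsup>2\<^esup>. (\<lambda>x. f (j, x)) ` e \<in> (\<Union>h<l. F h)} \<subseteq> (\<Union>i<k * l. G i)"
    proof
      fix e assume "e \<in> {e \<in> [{..<N}]\<^bsup>2\<^esup>. (\<lambda>x. f (j, x)) ` e \<in> (\<Union>h<l. F h)}"
      then obtain h where h: "h < l" "e \<in> [{..<N}]\<^bsup>2\<^esup>" "(\<lambda>x. f (j, x)) ` e \<in> F h"
        by auto
      then have "e \<in> G (j * l + h)"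
        by (simp add: G_def)
      moreover have "j * l + h < k * l"
      proof -
        have "j * l + h < Suc j * l" using h(1) by simp
        also have "\<dots> \<le> k * l" using j(1) by (intro mult_right_mono) auto
        finally show ?thesis .
      qed
      ultimately show "e \<in> (\<Union>i<k * l. G i)"
        by auto
    qed
    ultimately show "contains_K A (\<Union>i<k * l. G i) s"
      by (rule contains_K_mono[OF _ A'(1)])
  qed
qed

subsection \<open>The paraboloid linear space\<close>

type_synonym point = "(nat \<Rightarrow> nat) \<times> nat \<times> (nat \<Rightarrow> nat)"

text \<open>A point \<open>(x, z, u)\<close> is best read as the affine motion with start
  \<open>(x, z)\<close> and velocity \<open>(u, |u|^2)\<close>. The range of \<open>z\<close> is
  quadratic in \<open>d\<close> because \<open>|u|^2\<close> is.\<close>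

definition points :: "nat \<Rightarrow> nat \<Rightarrow> point set" where
  "points D d = ({..<D} \<rightarrow>\<^sub>E {..<d}) \<times> {..<d\<^sup>2} \<times> ({..<D} \<rightarrow>\<^sub>E {..<d})"

text \<open>The position of the motion at time \<open>i\<close>, tagged with \<open>i\<close>. Two
  points lie on a common line exactly if their motions meet at that time.\<close>

fun line :: "nat \<Rightarrow> nat \<Rightarrow> point \<Rightarrow> nat \<times> (nat \<Rightarrow> nat) \<times> nat" where
  "line D i (x, z, u) = (i, restrict (\<lambda>k. x k + i * u k) {..<D}, z + i * (\<Sum>k<D. (u k)\<^sup>2))"

declare line.simps [simp del]

text \<open>A box containing all labels with index below \<open>r\<close>. Up to factors in
  \<open>r\<close> and \<open>D\<close> it has \<open>d ^ (D + 2)\<close> elements against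
  \<open>d ^ (2 * D + 2)\<close> points, hence the near square root.\<close>

definition all_lines :: "nat \<Rightarrow> nat \<Rightarrow> nat \<Rightarrow> (nat \<times> (nat \<Rightarrow> nat) \<times> nat) set" where
  "all_lines D d r = {..<r} \<times> ({..<D} \<rightarrow>\<^sub>E {..<r * d}) \<times> {..<r * D * d\<^sup>2}"

lemma finite_points: "finite (points D d)"
  and card_points: "card (points D d) = d ^ (2 * D + 2)"
proof -
  show "finite (points D d)"
    by (auto simp: points_def intro!: finite_PiE)
  have "d ^ (2 * D + 2) = d ^ D * (d\<^sup>2 * d ^ D)"
    by (simp flip: power_add add: mult_2)
  then show "card (points D d) = d ^ (2 * D + 2)"
    by (simp add: points_def card_cartesian_product card_PiE)
qed

lemma finite_all_lines: "finite (all_lines D d r)"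
  and card_all_lines: "card (all_lines D d r) = r * ((r * d) ^ D * (r * D * d\<^sup>2))"
  by (auto simp: all_lines_def card_cartesian_product card_PiE intro!: finite_PiE)

lemma line_in_all_lines:
  assumes "p \<in> points D d" "i < r" "D > 0"
  shows "line D i p \<in> all_lines D d r"
proof -
  obtain x z u where p: "p = (x, z, u)"
    by (cases p)
  have bounds: "\<And>k. k < D \<Longrightarrow> x k < d" "\<And>k. k < D \<Longrightarrow> u k < d" "z < d\<^sup>2"
    using assms(1) by (auto simp: p points_def)
  have "x k + i * u k < r * d" if "k < D" for k
  proof -
    have "x k + i * u k < d + i * d"
      using bounds(1,2)[OF that] by (intro add_less_le_mono mult_le_mono2) auto
    also have "\<dots> = Suc i * d"
      by simp
    also have "\<dots> \<le> r * d"
      using assms(2) by (intro mult_le_mono1) auto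
    finally show ?thesis .
  qed
  moreover have "z + i * (\<Sum>k<D. (u k)\<^sup>2) < r * D * d\<^sup>2"
  proof -
    have "(\<Sum>k<D. (u k)\<^sup>2) \<le> (\<Sum>k<D. d\<^sup>2)"
      using bounds(2) by (intro sum_mono power_mono) (auto intro: less_imp_le)
    then have "z + i * (\<Sum>k<D. (u k)\<^sup>2) < d\<^sup>2 + i * (D * d\<^sup>2)"
      using bounds(3) by (intro add_less_le_mono mult_le_mono2) auto
    also have "\<dots> \<le> D * d\<^sup>2 + i * (D * d\<^sup>2)"
      using assms(3) by simp
    also have "\<dots> = Suc i * (D * d\<^sup>2)"
      by simp
    also have "\<dots> \<le> r * (D * d\<^sup>2)"
      using assms(2) by (intro mult_le_mono1) auto
    finally show ?thesis
      by (simp add: mult.assoc)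
  qed
  ultimately show ?thesis
    using assms(2) by (auto simp: p all_lines_def line.simps)
qed

lemma line_eqD: "line D i p = line D j q \<Longrightarrow> i = j"
  by (cases p; cases q) (auto simp: line.simps)

lemma line_eq_iff:
  "line D i (x, z, u) = line D i (y, w, v) \<longleftrightarrow>
    (\<forall>k<D. x k + i * u k = y k + i * v k) \<and>
    z + i * (\<Sum>k<D. (u k)\<^sup>2) = w + i * (\<Sum>k<D. (v k)\<^sup>2)"
  by (auto simp: line.simps fun_eq_iff restrict_def)

text \<open>A motion is determined by its velocity and its position at one time.\<close>

lemma point_eqI:
  assumes "(x, z, u) \<in> points D d" "(y, w, v) \<in> points D d"
    and "line D i (x, z, u) = line D i (y, w, v)"
    and "\<And>k. k < D \<Longrightarrow> u k = v k"
  shows "(x, z, u) = (y, w, v)"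
proof -
  have ext: "x \<in> {..<D} \<rightarrow>\<^sub>E {..<d}" "u \<in> {..<D} \<rightarrow>\<^sub>E {..<d}"
      "y \<in> {..<D} \<rightarrow>\<^sub>E {..<d}" "v \<in> {..<D} \<rightarrow>\<^sub>E {..<d}"
    using assms(1,2) by (simp_all add: points_def)
  have "u = v"
    using assms(4) by (intro PiE_ext[OF ext(2,4)]) simp
  moreover have "x = y"
    using assms(3,4) by (intro PiE_ext[OF ext(1,3)]) (simp add: line_eq_iff)
  ultimately show ?thesis
    using assms(3) by (simp add: line_eq_iff)
qed

text \<open>Two motions that meet at two different times have the same velocity, hence
  coincide.\<close>

lemma line_unique:
  assumes "p \<in> points D d" "q \<in> points D d" "p \<noteq> q"
    and "line D i p = line D i q" "line D j p = line D j q"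
  shows "i = j"
proof (rule ccontr)
  assume "i \<noteq> j"
  obtain x z u y w v where pq: "p = (x, z, u)" "q = (y, w, v)"
    by (cases p; cases q)
  have "u k = v k" if "k < D" for k
  proof -
    have "int (x k) + int i * int (u k) = int (y k) + int i * int (v k)"
      "int (x k) + int j * int (u k) = int (y k) + int j * int (v k)"
      using assms(4,5) that unfolding pq line_eq_iff by (metis of_nat_add of_nat_mult)+
    then have "(int i - int j) * (int (u k) - int (v k)) = 0"
      by algebra
    then show ?thesis
      using \<open>i \<noteq> j\<close> by simp
  qed
  then have "p = q"
    using assms(1,2,4) unfolding pq by (intro point_eqI[of x z u D d y w v i])
  then show False
    using \<open>p \<noteq> q\<close> by simp
qed

text \<open>A convex combination of two distinct points of a paraboloid lies off the paraboloid;
  the coefficients may have any sign here.\<close>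

lemma paraboloid_collinear:
  fixes a b c :: "nat \<Rightarrow> int" and \<alpha> \<beta> :: int
  assumes "\<And>k. k < D \<Longrightarrow> \<alpha> * a k + \<beta> * b k = (\<alpha> + \<beta>) * c k"
    and "\<alpha> * (\<Sum>k<D. (a k)\<^sup>2) + \<beta> * (\<Sum>k<D. (b k)\<^sup>2) = (\<alpha> + \<beta>) * (\<Sum>k<D. (c k)\<^sup>2)"
    and "\<alpha> \<noteq> 0" "\<beta> \<noteq> 0" "k < D"
  shows "a k = b k"
proof -
  have "\<alpha> * \<beta> * (\<Sum>k<D. (a k - b k)\<^sup>2) = (\<Sum>k<D. \<alpha> * \<beta> * (a k - b k)\<^sup>2)"
    by (simp add: sum_distrib_left)
  \<comment> \<open>This is \<open>\<alpha> * \<beta> * (a - b)^2 = (\<alpha> + \<beta>) * (\<alpha>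
    * a^2 + \<beta> * b^2) - (\<alpha> * a + \<beta> * b)^2\<close> in each coordinate.\<close>
  also have "\<dots> = (\<Sum>k<D. (\<alpha> + \<beta>) * (\<alpha> * (a k)\<^sup>2 + \<beta> * (b k)\<^sup>2 - (\<alpha> + \<beta>) * (c k)\<^sup>2))"
  proof (rule sum.cong[OF refl])
    fix k assume "k \<in> {..<D}"
    then have "\<alpha> * a k + \<beta> * b k = (\<alpha> + \<beta>) * c k"
      using assms(1) by simp
    then show "\<alpha> * \<beta> * (a k - b k)\<^sup>2 =
        (\<alpha> + \<beta>) * (\<alpha> * (a k)\<^sup>2 + \<beta> * (b k)\<^sup>2 - (\<alpha> + \<beta>) * (c k)\<^sup>2)"
      by algebra
  qed
  also have "\<dots> = (\<alpha> + \<beta>) * (\<alpha> * (\<Sum>k<D. (a k)\<^sup>2) + \<beta> * (\<Sum>k<D. (b k)\<^sup>2) -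
      (\<alpha> + \<beta>) * (\<Sum>k<D. (c k)\<^sup>2))"
    by (simp add: sum_distrib_left sum.distrib sum_subtractf algebra_simps)
  also have "\<dots> = 0"
    using assms(2) by simp
  finally have "(\<Sum>k<D. (a k - b k)\<^sup>2) = 0"
    using assms(3,4) by simp
  then have "\<forall>k\<in>{..<D}. (a k - b k)\<^sup>2 = 0"
    by (subst (asm) sum_nonneg_eq_0_iff) auto
  then show ?thesis
    using assms(5) by simp
qed

text \<open>Adding the three meeting conditions cancels the starts and leaves
  \<open>(i - h) * u1 + (j - i) * u2 + (h - j) * u3 = 0\<close>, and the same for the squared norms.
  The coefficients sum to 0 and the first two are nonzero, so \<open>paraboloid_collinear\<close>
  gives \<open>u1 = u2\<close>.\<close>

lemma no_triangle:
  assumes "p \<in> points D d" "q \<in> points D d"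
    and "line D i p = line D i q" "line D j q = line D j s" "line D h s = line D h p"
    and "i \<noteq> j" "i \<noteq> h"
  shows "p = q"
proof -
  obtain x1 z1 u1 x2 z2 u2 x3 z3 u3
    where pqs: "p = (x1, z1, u1)" "q = (x2, z2, u2)" "s = (x3, z3, u3)"
    by (cases p; cases q; cases s)
  define S where "S u = (\<Sum>k<D. (int (u k))\<^sup>2)" for u :: "nat \<Rightarrow> nat"
  have S: "int (\<Sum>k<D. (u k)\<^sup>2) = S u" for u
    by (simp add: S_def)
  have vec: "(int i - int h) * int (u1 k) + (int j - int i) * int (u2 k) =
      ((int i - int h) + (int j - int i)) * int (u3 k)" if "k < D" for k
  proof -
    have "int (x1 k) + int i * int (u1 k) = int (x2 k) + int i * int (u2 k)"
      "int (x2 k) + int j * int (u2 k) = int (x3 k) + int j * int (u3 k)"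
      "int (x3 k) + int h * int (u3 k) = int (x1 k) + int h * int (u1 k)"
      using assms(3-5) that unfolding pqs line_eq_iff by (metis of_nat_add of_nat_mult)+
    then show ?thesis by algebra
  qed
  have "int z1 + int i * S u1 = int z2 + int i * S u2"
    "int z2 + int j * S u2 = int z3 + int j * S u3"
    "int z3 + int h * S u3 = int z1 + int h * S u1"
    using assms(3-5) unfolding pqs line_eq_iff S[symmetric] by (metis of_nat_add of_nat_mult)+
  then have "(int i - int h) * S u1 + (int j - int i) * S u2 =
      ((int i - int h) + (int j - int i)) * S u3"
    by algebra
  then have "u1 k = u2 k" if "k < D" for k
    using paraboloid_collinear[OF vec _ _ _ that] assms(6,7) by (simp add: S_def)
  then show ?thesis
    using assms(1-3) unfolding pqs by (intro point_eqI[of x1 z1 u1 D d x2 z2 u2 i])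
qed

text \<open>
  The box sizes are powers of \<open>r\<close>, which is also the number of lines through a point, so that all
  counts are powers of \<open>r\<close>.
\<close>

lemma exists_paraboloid_layer:
  fixes D r s b l :: nat
  assumes "0 < D" "D \<le> r" "0 < s" "3 \<le> b"
    and small: "r ^ (2 * D\<^sup>2 + 2 * D) * s * (s - 1) ^ r < s ^ r"
    and free: "K_free (replicate l b) {..<s} ([{..<s}]\<^bsup>2\<^esup>)"
  shows "\<exists>(P :: point set) F. finite P \<and> card P = r ^ (2 * D\<^sup>2 + 2 * D) \<and>
    (\<forall>h. F h \<subseteq> [P]\<^bsup>2\<^esup>) \<and> (\<forall>h<l. \<not> contains_K P (F h) b) \<and>
    (\<forall>A\<subseteq>P. r ^ (D\<^sup>2 + 3 * D + 3) \<le> card A \<longrightarrow> contains_K A (\<Union>h<l. F h) s)"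
proof -
  define P where "P = points D (r ^ D)"
  define B where "B = all_lines D (r ^ D) r"
  define lines where "lines p = (\<lambda>i. line D i p) ` {..<r}" for p
  have cardP: "card P = r ^ (2 * D\<^sup>2 + 2 * D)"
  proof -
    have "D * (2 * D + 2) = 2 * D\<^sup>2 + 2 * D"
      by (simp add: power2_eq_square algebra_simps)
    then show ?thesis
      unfolding P_def card_points power_mult[symmetric] by (rule arg_cong)
  qed
  have "r > 0"
    using assms by simp
  have "B \<noteq> {}"
    using card_all_lines[of D "r ^ D" r] \<open>r > 0\<close> \<open>0 < D\<close> by (auto simp: B_def)
  have cardB: "card B \<le> r ^ (D\<^sup>2 + 3 * D + 3)"
  proof -
    have "card B = D * (r * (r ^ Suc D) ^ D * (r * r ^ (D * 2)))"
      by (simp add: B_def card_all_lines power_mult)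
    also have "r * (r ^ Suc D) ^ D * (r * r ^ (D * 2)) = r ^ (1 + Suc D * D + (1 + D * 2))"
      by (simp only: power_add power_mult power_one_right)
    also have "1 + Suc D * D + (1 + D * 2) = D\<^sup>2 + 3 * D + 2"
      by (simp add: power2_eq_square)
    \<comment> \<open>One further power of \<open>r\<close> absorbs the factor
      \<open>D\<close>.\<close>
    also have "D * r ^ (D\<^sup>2 + 3 * D + 2) \<le> r * r ^ (D\<^sup>2 + 3 * D + 2)"
      using \<open>D \<le> r\<close> by (rule mult_le_mono1)
    also have "\<dots> = r ^ (D\<^sup>2 + 3 * D + 3)"
      by (simp add: numeral_eq_Suc)
    finally show ?thesis .
  qed
  \<comment> \<open>A line is recovered from its index and any of its points, so distinct lines
    through a common point have distinct indices.\<close>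
  have on_line: "line D (fst L) p = L" if "L \<in> lines p" for L p
    using that by (cases p) (auto simp: lines_def line.simps)
  have linear: "L = M" if "x \<in> P" "y \<in> P" "x \<noteq> y" "L \<in> lines x" "L \<in> lines y" "M \<in> lines x" "M \<in> lines y"
    for x y L M
    using line_unique[of x D "r ^ D" y "fst L" "fst M"] on_line[of L] on_line[of M] that
    unfolding P_def by metis
  have triangle: "L = M" if "x \<in> P" "y \<in> P" "z \<in> P" "x \<noteq> y" "y \<noteq> z" "x \<noteq> z"
    "L \<in> lines x" "L \<in> lines y" "M \<in> lines y" "M \<in> lines z" "N \<in> lines z" "N \<in> lines x"
    for x y z L M N
  proof (rule ccontr)
    assume "L \<noteq> M"
    have "N \<noteq> L"
      using linear[of y z L M] that \<open>L \<noteq> M\<close> by blast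
    have "fst L \<noteq> fst M" "fst L \<noteq> fst N"
      using on_line that \<open>L \<noteq> M\<close> \<open>N \<noteq> L\<close> by metis+
    then have "x = y"
      using no_triangle[of x D "r ^ D" y "fst L" "fst M" z "fst N"] on_line that
      by (simp add: P_def)
    then show False
      using \<open>x \<noteq> y\<close> by simp
  qed
  have card_lines: "lines x \<subseteq> B \<and> card (lines x) = r" if "x \<in> P" for x
  proof
    show "lines x \<subseteq> B"
      using line_in_all_lines[of x D "r ^ D"] that \<open>0 < D\<close>
      unfolding lines_def B_def P_def by blast
    have "inj_on (\<lambda>i. line D i x) {..<r}"
      using line_eqD by (auto simp: inj_on_def)
    then show "card (lines x) = r"
      by (simp add: lines_def card_image)
  qed
  have finP: "finite P" and finB: "finite B"
    by (simp_all add: P_def B_def finite_points finite_all_lines)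
  have small': "card P * s * (s - 1) ^ r < s ^ r"
    using small cardP by simp
  have "\<exists>F :: nat \<Rightarrow> point set set. (\<forall>h. F h \<subseteq> [P]\<^bsup>2\<^esup>) \<and>
    (\<forall>h<l. \<not> contains_K P (F h) b) \<and>
    (\<forall>A\<subseteq>P. card B \<le> card A \<longrightarrow> contains_K A (\<Union>h<l. F h) s)"
    by (rule exists_layer[where lines = lines and r = r])
      (fact finP finB \<open>B \<noteq> {}\<close> \<open>0 < s\<close> card_lines linear triangle small' \<open>3 \<le> b\<close> free)+
  then obtain F :: "nat \<Rightarrow> point set set"
    where F: "\<And>h. F h \<subseteq> [P]\<^bsup>2\<^esup>" "\<And>h. h < l \<Longrightarrow> \<not> contains_K P (F h) b"
      "\<And>A. A \<subseteq> P \<Longrightarrow> card B \<le> card A \<Longrightarrow> contains_K A (\<Union>h<l. F h) s"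
    by metis
  show ?thesis
    using finP cardP F cardB by (intro exI[of _ P] exI[of _ F]) auto
qed

subsection \<open>Asymptotics\<close>

lemma indep_num_le:
  assumes "finite V" "s > 0" "\<And>A. A \<subseteq> V \<Longrightarrow> \<not> contains_K A E s \<Longrightarrow> card A \<le> m"
  shows "indep_num s V E \<le> m"
  unfolding indep_num_def
proof (rule Max.boundedI)
  show "finite {card A |A. A \<subseteq> V \<and> \<not> contains_K A E s}"
    using assms(1) by simp
  have "\<not> contains_K {} E s"
    using assms(2) by (simp add: contains_K_def nsets_empty_iff)
  then show "{card A |A. A \<subseteq> V \<and> \<not> contains_K A E s} \<noteq> {}"
    by blast
qed (use assms(3) in blast)

lemma erdos_rogers_le_indep_num:
  assumes "E \<subseteq> [{..<n}]\<^bsup>2\<^esup>" "K_free ks {..<n} E"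
  shows "erdos_rogers s ks n \<le> indep_num s {..<n} E"
  unfolding erdos_rogers_def
proof (rule Min_le)
  have "finite {E. E \<subseteq> [{..<n}]\<^bsup>2\<^esup>}"
    by (simp add: finite_imp_finite_nsets)
  then show "finite {indep_num s {..<n} E |E. E \<subseteq> [{..<n}]\<^bsup>2\<^esup> \<and> K_free ks {..<n} E}"
    by simp
qed (use assms in blast)

text \<open>The edgeless graph is admissible. This settles the case \<open>t < l\<close>, where the
  exponent is 1.\<close>

lemma erdos_rogers_le_self:
  assumes "b \<ge> 2" "s > 0"
  shows "erdos_rogers s (replicate t b) n \<le> n"
proof -
  have "K_free (replicate t b) {..<n} {}"
    using assms(1) by (intro K_free_cover[where t' = 0]) auto
  then have "erdos_rogers s (replicate t b) n \<le> indep_num s {..<n} {}"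
    by (intro erdos_rogers_le_indep_num) auto
  also have "\<dots> \<le> n"
    using assms(2) card_mono[of "{..<n}"] by (intro indep_num_le) auto
  finally show ?thesis .
qed

section \<open>Numerical estimates and choice of parameters\<close>

text \<open>The left side divided by \<open>fact m\<close> is a single term of the series of
  \<open>exp m\<close>, and \<open>exp 1 \<le> 3\<close>.\<close>

lemma power_self_le_fact: "m ^ m \<le> 3 ^ m * (fact m :: nat)"
proof -
  have "real m ^ m / fact m \<le> (\<Sum>j. real m ^ j / fact j)"
  proof -
    have "summable (\<lambda>j. real m ^ j / fact j)"
      using summable_exp[of "real m"] by (simp add: field_simps)
    from sum_le_suminf[OF this, of "{m}"] show ?thesis
      by simp
  qed
  also have "\<dots> = exp (real m)"
    by (simp add: exp_def field_simps)
  also have "\<dots> = exp 1 ^ m"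
    by (simp flip: exp_of_nat_mult)
  also have "\<dots> \<le> 3 ^ m"
    using exp_le by (intro power_mono) auto
  finally have "real (m ^ m) \<le> real (3 ^ m * fact m)"
    by (simp add: field_simps)
  then show ?thesis
    by (simp only: of_nat_le_iff)
qed

text \<open>A division-free form of the usual bound \<open>(e * n / m) ^ m\<close> for binomial
  coefficients, with 3 for \<open>e\<close>.\<close>

lemma binomial_mult_power_le: "(n choose m) * m ^ m \<le> (3 * n) ^ m"
proof -
  have "(n choose m) * m ^ m \<le> (n choose m) * (3 ^ m * fact m)"
    by (intro mult_le_mono2 power_self_le_fact)
  also have "\<dots> = 3 ^ m * ((n choose m) * fact m)"
    by simp
  also have "\<dots> \<le> 3 ^ m * n ^ m"
    by (intro mult_le_mono2 binomial_fact_pow)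
  finally show ?thesis
    by (simp add: power_mult_distrib)
qed

lemma eventually_poly_mult_power_less:
  fixes x c :: real
  assumes "0 \<le> x" "x < 1"
  shows "\<forall>\<^sub>F r in sequentially. c * (real r ^ Q * x ^ r) < 1"
proof -
  define q where "q = Suc Q"
  \<comment> \<open>Taking a root of \<open>x\<close> reduces the claim to the linear case
    \<open>r * y ^ r \<longlonglongrightarrow> 0\<close>.\<close>
  define y where "y = root q x"
  have "q > 0" by (simp add: q_def)
  have y: "y ^ q = x" "norm y < 1"
    using assms \<open>q > 0\<close> by (auto simp: y_def real_root_pow_pos2)
  have "(\<lambda>r. (real r * y ^ r) ^ q) \<longlonglongrightarrow> 0 ^ q"
    using y(2) by (intro tendsto_power powser_times_n_limit_0)
  moreover have "(real r * y ^ r) ^ q = real r ^ q * x ^ r" for r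
    unfolding power_mult_distrib y(1)[symmetric] power_mult[symmetric] by (simp add: mult.commute)
  ultimately have "(\<lambda>r. real r ^ q * x ^ r) \<longlonglongrightarrow> 0"
    using \<open>q > 0\<close> by (simp add: zero_power)
  then have "(\<lambda>r. \<bar>c\<bar> * (real r ^ q * x ^ r)) \<longlonglongrightarrow> \<bar>c\<bar> * 0"
    by (intro tendsto_mult tendsto_const)
  then have "\<forall>\<^sub>F r in sequentially. \<bar>c\<bar> * (real r ^ q * x ^ r) < 1"
    by (simp add: order_tendstoD(2))
  then show ?thesis
    using eventually_gt_at_top[of 0]
  proof eventually_elim
    case (elim r)
    have "c * (real r ^ Q * x ^ r) \<le> \<bar>c\<bar> * (real r ^ q * x ^ r)"
      using elim(2) assms(1) by (intro mult_mono) (auto simp: q_def intro!: power_increasing)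
    then show ?case
      using elim(1) by linarith
  qed
qed

text \<open>
  After multiplication by \<open>m\<^bsup>m\<^esup>\<close> both sides can be compared by their \<open>m\<close>-th roots.
\<close>

lemma blowup_numerics:
  fixes N r k p Q a m :: nat
  assumes "N \<le> r ^ (p + k * (Q - p))" "r ^ Q \<le> 3 ^ r" "10 \<le> r" "0 < k" "0 < p" "p \<le> Q"
    and a: "a = r ^ (p - 1)" and m: "m = r ^ p"
  shows "(N choose m) * ((r ^ Q) ^ a * a ^ m) ^ k < (r ^ Q) ^ (m * k)"
proof -
  have "m > 0" "m = r * a"
    using assms by (auto simp flip: power_Suc)
  \<comment> \<open>One 3 comes from the binomial coefficient and one for each map from the choice
    of its \<open>a\<close>-set; \<open>r \<ge> 10\<close> outweighs them all.\<close>
  have "(3::nat) ^ (k + 1) \<le> 3 ^ (2 * k)"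
    using \<open>0 < k\<close> by (intro power_increasing) auto
  also have "\<dots> = 9 ^ k"
    by (simp add: power_mult)
  also have "\<dots> < r ^ k"
    using assms by (intro power_strict_mono) auto
  finally have three: "3 ^ (k + 1) < r ^ k" .
  have "3 * N * (3 * a) ^ k = 3 ^ (k + 1) * (N * a ^ k)"
    by (simp add: power_mult_distrib)
  also have "\<dots> \<le> 3 ^ (k + 1) * (r ^ (p + k * (Q - p)) * r ^ ((p - 1) * k))"
    using assms(1) by (intro mult_le_mono2 mult_le_mono) (simp_all add: a power_mult)
  also have "\<dots> < r ^ k * (r ^ (p + k * (Q - p)) * r ^ ((p - 1) * k))"
    using three assms(3) by (intro mult_strict_right_mono) auto
  also have "\<dots> = r ^ (k + (p + k * (Q - p) + (p - 1) * k))"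
    by (simp only: power_add)
  also have "k + (p + k * (Q - p) + (p - 1) * k) = p + Q * k"
  proof -
    obtain Q' p' where "Q = p + Q'" "p = Suc p'"
      using \<open>p \<le> Q\<close> \<open>0 < p\<close> by (metis gr0_implies_Suc le_Suc_ex)
    then show ?thesis
      by (simp add: algebra_simps)
  qed
  also have "r ^ (p + Q * k) = m * (r ^ Q) ^ k"
    by (simp add: m power_add power_mult)
  finally have base: "3 * N * (3 * a) ^ k < m * (r ^ Q) ^ k" .
  \<comment> \<open>Since \<open>m = r * a\<close>, the factor \<open>(r ^ Q) ^ a\<close> is at most
    \<open>3 ^ m\<close>. This is the reason to take \<open>m\<close> larger than \<open>a\<close>
    by a factor \<open>r\<close>.\<close>
  have "m ^ m * ((N choose m) * ((r ^ Q) ^ a * a ^ m) ^ k) \<le>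
      m ^ m * ((N choose m) * ((3 ^ r) ^ a * a ^ m) ^ k)"
    using assms(2) by (intro mult_le_mono2 power_mono mult_le_mono1) auto
  also have "\<dots> = (N choose m) * m ^ m * (((3 * a) ^ k) ^ m)"
    by (simp add: \<open>m = r * a\<close> power_mult_distrib mult.commute[of _ k] flip: power_mult)
  also have "\<dots> \<le> (3 * N) ^ m * ((3 * a) ^ k) ^ m"
    by (intro mult_le_mono1 binomial_mult_power_le)
  also have "\<dots> = (3 * N * (3 * a) ^ k) ^ m"
    by (simp only: power_mult_distrib)
  also have "\<dots> < (m * (r ^ Q) ^ k) ^ m"
    using base \<open>m > 0\<close> by (intro power_strict_mono) auto
  also have "\<dots> = m ^ m * (r ^ Q) ^ (m * k)"
    by (simp add: power_mult_distrib mult.commute[of m k] mult.assoc flip: power_mult)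
  finally show ?thesis
    by simp
qed

text \<open>The layer has \<open>n = r ^ Q\<close> points and threshold \<open>r ^ (p - 1)\<close>,
  and the blow-up uses \<open>m = r ^ p\<close>. The admissible \<open>N\<close> reach
  \<open>m * (n / m) ^ k\<close>.\<close>

lemma erdos_rogers_power_bound:
  fixes D k s b l t :: nat
  defines "p \<equiv> D\<^sup>2 + 3 * D + 4" and "Q \<equiv> 2 * D\<^sup>2 + 2 * D"
  assumes "D \<ge> 3" "k > 0" "s > 0" "b \<ge> 3" "k * l \<le> t"
    and free: "K_free (replicate l b) {..<s} ([{..<s}]\<^bsup>2\<^esup>)"
  shows "\<forall>\<^sub>F r in sequentially. \<forall>N. N \<le> r ^ (p + k * (Q - p)) \<longrightarrow>
    erdos_rogers s (replicate t b) N \<le> r ^ p"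
proof -
  have "3 * D \<le> D\<^sup>2"
    using \<open>D \<ge> 3\<close> by (simp add: power2_eq_square)
  then have "p \<le> Q"
    using \<open>D \<ge> 3\<close> by (simp add: p_def Q_def)
  \<comment> \<open>The first limit provides the union bound for the labelling, the second the
    inequality \<open>r ^ Q \<le> 3 ^ r\<close> for the blow-up.\<close>
  have "\<forall>\<^sub>F r in sequentially. real s * (real r ^ Q * ((real s - 1) / real s) ^ r) < 1"
    using \<open>s > 0\<close> by (intro eventually_poly_mult_power_less) auto
  moreover have "\<forall>\<^sub>F r in sequentially. 1 * (real r ^ Q * (1 / 3) ^ r) < 1"
    by (intro eventually_poly_mult_power_less) auto
  ultimately show ?thesis
    using eventually_ge_at_top[of "max 10 D"]
  proof eventually_elim
    case (elim r)
    have "real (r ^ Q * s * (s - 1) ^ r) < real (s ^ r)"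
      using elim(1) \<open>s > 0\<close> by (simp add: power_divide field_simps of_nat_diff)
    then have small: "r ^ Q * s * (s - 1) ^ r < s ^ r"
      by (simp only: of_nat_less_iff)
    have "real (r ^ Q) \<le> real (3 ^ r)"
      using elim(2) by (simp add: power_divide field_simps)
    then have le3: "r ^ Q \<le> 3 ^ r"
      by (simp only: of_nat_le_iff)
    have r: "r \<ge> 10" "D \<le> r"
      using elim(3) by auto
    have "0 < D"
      using \<open>D \<ge> 3\<close> by simp
    have p1: "D\<^sup>2 + 3 * D + 3 = p - 1"
      by (simp add: p_def)
    obtain P :: "point set" and F
      where P: "finite P" "card P = r ^ Q" "\<And>h. F h \<subseteq> [P]\<^bsup>2\<^esup>"
        "\<And>h. h < l \<Longrightarrow> \<not> contains_K P (F h) b"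
        "\<And>A. A \<subseteq> P \<Longrightarrow> r ^ (p - 1) \<le> card A \<Longrightarrow> contains_K A (\<Union>h<l. F h) s"
      using exists_paraboloid_layer[OF \<open>0 < D\<close> r(2) \<open>s > 0\<close> \<open>b \<ge> 3\<close> small[unfolded Q_def] free]
      unfolding p1 Q_def[symmetric] by metis
    show ?case
    proof (intro allI impI)
      fix N assume N: "N \<le> r ^ (p + k * (Q - p))"
      have small': "(N choose r ^ p) * (card P ^ r ^ (p - 1) * (r ^ (p - 1)) ^ r ^ p) ^ k < card P ^ (r ^ p * k)"
        unfolding P(2) using N le3 r(1) \<open>k > 0\<close> \<open>p \<le> Q\<close>
        by (intro blowup_numerics[where p = p]) (auto simp: p_def)
      have le_P: "r ^ (p - 1) \<le> card P"
        unfolding P(2) using \<open>p \<le> Q\<close> r(1) by (intro power_increasing) auto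
      have "2 \<le> b"
        using \<open>b \<ge> 3\<close> by simp
      have "\<exists>E. E \<subseteq> [{..<N}]\<^bsup>2\<^esup> \<and> K_free (replicate t b) {..<N} E \<and>
          (\<forall>A\<subseteq>{..<N}. r ^ p \<le> card A \<longrightarrow> contains_K A E s)"
        by (rule exists_blowup_union[where F = F and a = "r ^ (p - 1)"])
          (fact P(1) le_P \<open>k > 0\<close> \<open>2 \<le> b\<close> \<open>k * l \<le> t\<close> P(3) P(4) P(5) small')+
      then obtain E where E: "E \<subseteq> [{..<N}]\<^bsup>2\<^esup>" "K_free (replicate t b) {..<N} E"
        "\<And>A. A \<subseteq> {..<N} \<Longrightarrow> r ^ p \<le> card A \<Longrightarrow> contains_K A E s"
        by metis
      have "erdos_rogers s (replicate t b) N \<le> indep_num s {..<N} E"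
        by (intro erdos_rogers_le_indep_num E)
      also have "\<dots> \<le> r ^ p"
        using E(3) \<open>s > 0\<close> by (intro indep_num_le) (auto intro: le_cases)
      finally show "erdos_rogers s (replicate t b) N \<le> r ^ p" .
    qed
  qed
qed

section \<open>From bounds by powers of \<open>r\<close> to an exponent with an error term\<close>

text \<open>For given \<open>N\<close>, the base \<open>r\<close> is \<open>N\<close> to the power
  \<open>1 / W\<close>, rounded up. Rounding at most doubles it and costs a factor
  \<open>2 ^ p\<close>, which the strict gap between \<open>p / W\<close> and \<open>e\<close>
  absorbs.\<close>

lemma eventually_le_powr_of_power_bound:
  fixes f :: "nat \<Rightarrow> nat" and p W :: nat and e :: real
  assumes bound: "\<forall>\<^sub>F r in sequentially. \<forall>N. N \<le> r ^ W \<longrightarrow> f N \<le> r ^ p"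
    and "W > 0" "real p / real W < e"
  shows "\<forall>\<^sub>F N in sequentially. real (f N) \<le> real N powr e"
proof -
  define r where "r N = nat \<lceil>real N powr (1 / real W)\<rceil>" for N
  have "filterlim r at_top sequentially"
    unfolding r_def using \<open>W > 0\<close> by real_asymp
  then have "\<forall>\<^sub>F N in sequentially. \<forall>M. M \<le> r N ^ W \<longrightarrow> f M \<le> r N ^ p"
    using bound by (rule eventually_compose_filterlim[rotated])
  moreover have "\<forall>\<^sub>F N in sequentially. 2 ^ p * real N powr (real p / real W) \<le> real N powr e"
    using assms(3) by real_asymp
  ultimately show ?thesis
    using eventually_ge_at_top[of 1]
  proof eventually_elim
    case (elim N)
    define y where "y = real N powr (1 / real W)"
    have "y \<ge> 1"
      using elim(3) by (simp add: y_def ge_one_powr_ge_zero)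
    then have r: "y \<le> real (r N)" "real (r N) \<le> 2 * y"
      by (simp_all add: r_def flip: y_def) linarith+
    have "real N = y ^ W"
      using elim(3) \<open>W > 0\<close> by (simp add: y_def powr_power)
    also have "\<dots> \<le> real (r N) ^ W"
      using r \<open>y \<ge> 1\<close> by (intro power_mono) auto
    finally have "N \<le> r N ^ W"
      by (simp flip: of_nat_power)
    then have "real (f N) \<le> real (r N ^ p)"
      using elim(1) by (simp only: of_nat_le_iff)
    also have "\<dots> \<le> (2 * y) ^ p"
      unfolding of_nat_power using r(2) by (intro power_mono) auto
    also have "\<dots> = 2 ^ p * real N powr (real p / real W)"
      using elim(3) by (simp add: y_def power_mult_distrib powr_power)
    finally show ?case
      using elim(2) by linarith
  qed
qed

text \<open>Merges the bounds for all fixed \<open>\<delta>\<close>, each valid from its own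
  starting point, into one \<open>o(1)\<close> term.\<close>

lemma exists_vanishing_exponent:
  fixes f :: "nat \<Rightarrow> nat" and e :: real
  assumes "\<And>\<delta>. \<delta> > 0 \<Longrightarrow> \<forall>\<^sub>F n in sequentially. real (f n) \<le> real n powr (e + \<delta>)"
  shows "\<exists>\<epsilon> :: nat \<Rightarrow> real. \<epsilon> \<longlonglongrightarrow> 0 \<and>
    (\<forall>\<^sub>F n in sequentially. real (f n) \<le> real n powr (e + \<epsilon> n))"
proof -
  \<comment> \<open>The excess of the true exponent of \<open>f n\<close> over \<open>e\<close>, cut
    off below at 0. For \<open>f n = 0\<close>, which has no exponent, the excess 0 serves.\<close>
  define \<epsilon> where "\<epsilon> n = (if f n = 0 then 0 else max 0 (ln (real (f n)) / ln (real n) - e))" for n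
  have "\<epsilon> \<longlonglongrightarrow> 0"
  proof (rule LIMSEQ_I)
    fix \<delta> :: real assume "\<delta> > 0"
    then have "\<forall>\<^sub>F n in sequentially. real (f n) \<le> real n powr (e + \<delta> / 2)"
      by (intro assms) simp
    then have "\<forall>\<^sub>F n in sequentially. norm (\<epsilon> n - 0) < \<delta>"
      using eventually_ge_at_top[of 2]
    proof eventually_elim
      case (elim n)
      show ?case
      proof (cases "f n = 0")
        case False
        then have "ln (real (f n)) \<le> ln (real n powr (e + \<delta> / 2))"
          using elim by (subst ln_le_cancel_iff) auto
        then have "ln (real (f n)) / ln (real n) \<le> e + \<delta> / 2"
          using elim by (simp add: ln_powr pos_divide_le_eq)
        then show ?thesis
          using \<open>\<delta> > 0\<close> by (auto simp: \<epsilon>_def)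
      qed (use \<open>\<delta> > 0\<close> in \<open>simp add: \<epsilon>_def\<close>)
    qed
    then show "\<exists>n0. \<forall>n\<ge>n0. norm (\<epsilon> n - 0) < \<delta>"
      by (simp add: eventually_sequentially)
  qed
  moreover have "\<forall>\<^sub>F n in sequentially. real (f n) \<le> real n powr (e + \<epsilon> n)"
    using eventually_ge_at_top[of 2]
  proof eventually_elim
    case (elim n)
    show ?case
    proof (cases "f n = 0")
      case False
      have "real (f n) = real n powr (ln (real (f n)) / ln (real n))"
        using False elim by (simp add: powr_def)
      also have "\<dots> \<le> real n powr (e + \<epsilon> n)"
        using False elim by (intro powr_mono) (auto simp: \<epsilon>_def)
      finally show ?thesis .
    qed simp
  qed
  ultimately show ?thesis
    by blast
qed

section \<open>Multicolour Ramsey numbers\<close>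

text \<open>With one colour for each pair, a clique on three vertices already needs more than one
  colour.\<close>

lemma K_free_complete_many_colours:
  fixes s m b :: nat
  assumes "b \<ge> 3" "m \<le> s"
  shows "K_free (replicate (card ([{..<s}]\<^bsup>2\<^esup>)) b) {..<m} ([{..<m}]\<^bsup>2\<^esup>)"
proof -
  have "finite ([{..<s}]\<^bsup>2\<^esup>)"
    by (simp add: finite_imp_finite_nsets)
  then obtain g where bij: "bij_betw g ([{..<s}]\<^bsup>2\<^esup>) {0..<card ([{..<s}]\<^bsup>2\<^esup>)}"
    using ex_bij_betw_finite_nat by blast
  define K where "K = card ([{..<s}]\<^bsup>2\<^esup>)"
  have sub: "[{..<m}]\<^bsup>2\<^esup> \<subseteq> [{..<s}]\<^bsup>2\<^esup>"
    using assms(2) by (intro nsets_mono) auto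
  have inj: "inj_on g ([{..<m}]\<^bsup>2\<^esup>)"
    using bij_betw_imp_inj_on[OF bij] sub by (rule inj_on_subset)
  have g_less: "g e < K" if "e \<in> [{..<m}]\<^bsup>2\<^esup>" for e
    using bij_betwE[OF bij] sub that unfolding K_def by (meson atLeastLessThan_iff subsetD)
  have "K_free (replicate K b) {..<m} ([{..<m}]\<^bsup>2\<^esup>)"
  proof (rule K_free_cover[where t' = K and F = "\<lambda>i. {e \<in> [{..<m}]\<^bsup>2\<^esup>. g e = i}"])
    fix i
    show "\<not> contains_K {..<m} {e \<in> [{..<m}]\<^bsup>2\<^esup>. g e = i} b"
    proof
      assume "contains_K {..<m} {e \<in> [{..<m}]\<^bsup>2\<^esup>. g e = i} b"
      then obtain A where A: "A \<in> [{..<m}]\<^bsup>b\<^esup>" "clique A {e \<in> [{..<m}]\<^bsup>2\<^esup>. g e = i}"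
        by (auto simp: contains_K_def)
      then have "3 \<le> card A"
        using assms(1) by (simp add: nsets_def)
      then obtain B where "B \<subseteq> A" "card B = 3"
        using obtain_subset_with_card_n[of 3 A] by metis
      then obtain x y z where xyz: "x \<in> A" "y \<in> A" "z \<in> A" "x \<noteq> y" "y \<noteq> z" "x \<noteq> z"
        by (auto simp: card_3_iff)
      then have "{x, y} \<in> {e \<in> [{..<m}]\<^bsup>2\<^esup>. g e = i}" "{x, z} \<in> {e \<in> [{..<m}]\<^bsup>2\<^esup>. g e = i}"
        using A(2) unfolding clique_def by blast+
      then have "{x, y} = {x, z}"
        using inj_onD[OF inj, of "{x, y}" "{x, z}"] by auto
      then show False
        using xyz by (auto simp: doubleton_eq_iff)
    qed
  qed (use g_less assms(1) in auto)
  then show ?thesis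
    by (simp add: K_def)
qed

text \<open>Ramsey's theorem for pairs, in the form that makes the \<open>LEAST\<close> in
  \<open>multicolor_ramsey\<close> attained.\<close>

lemma ramsey_not_K_free: "\<exists>m::nat. \<not> K_free ks {..<m} ([{..<m}]\<^bsup>2\<^esup>)"
proof -
  obtain m :: nat where m: "partn_lst {..<m} ks 2"
    using ramsey_full by blast
  have "\<not> K_free ks {..<m} ([{..<m}]\<^bsup>2\<^esup>)"
  proof
    assume "K_free ks {..<m} ([{..<m}]\<^bsup>2\<^esup>)"
    then obtain c where c: "c \<in> [{..<m}]\<^bsup>2\<^esup> \<rightarrow> {..<length ks}"
      "\<And>j. j < length ks \<Longrightarrow> \<not> contains_K {..<m} {e \<in> [{..<m}]\<^bsup>2\<^esup>. c e = j} (ks ! j)"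
      by (auto simp: K_free_def)
    obtain i H where iH: "i < length ks" "H \<in> [{..<m}]\<^bsup>(ks ! i)\<^esup>" "c ` [H]\<^bsup>2\<^esup> \<subseteq> {i}"
      using partn_lstE[OF m c(1) refl] by metis
    have "clique H {e \<in> [{..<m}]\<^bsup>2\<^esup>. c e = i}"
      unfolding clique_def
    proof (intro ballI impI)
      fix v w assume vw: "v \<in> H" "w \<in> H" "v \<noteq> w"
      then have "{v, w} \<in> [H]\<^bsup>2\<^esup>"
        by simp
      moreover from this have "{v, w} \<in> [{..<m}]\<^bsup>2\<^esup>"
        using iH(2) by (auto simp: nsets_def)
      ultimately show "{v, w} \<in> {e \<in> [{..<m}]\<^bsup>2\<^esup>. c e = i}"
        using iH(3) by blast
    qed
    then show False
      using c(2)[OF iH(1)] iH(2) by (auto simp: contains_K_def)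
  qed
  then show ?thesis
    by blast
qed

text \<open>Makes the \<open>LEAST\<close> that defines \<open>l\<close> attained: as many colours
  as the complete graph on \<open>s\<close> vertices has edges are enough.\<close>

lemma exists_multicolor_ramsey_greater:
  fixes s b :: nat
  assumes "b \<ge> 3"
  shows "\<exists>k. multicolor_ramsey k b > s"
proof -
  define K where "K = card ([{..<s}]\<^bsup>2\<^esup>)"
  have "\<not> K_free (replicate K b) {..<multicolor_ramsey K b} ([{..<multicolor_ramsey K b}]\<^bsup>2\<^esup>)"
    unfolding multicolor_ramsey_def using ramsey_not_K_free by (rule LeastI_ex)
  then have "multicolor_ramsey K b > s"
    using K_free_complete_many_colours[OF assms, of "multicolor_ramsey K b" s]
    by (auto simp: K_def not_le[symmetric])
  then show ?thesis ..
qed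

lemma K_free_of_less_multicolor_ramsey:
  fixes s l b :: nat
  assumes "s < multicolor_ramsey l b"
  shows "K_free (replicate l b) {..<s} ([{..<s}]\<^bsup>2\<^esup>)"
  using assms not_less_Least unfolding multicolor_ramsey_def by blast

text \<open>The coefficients of \<open>D^2\<close> in numerator and denominator are 1 and
  \<open>1 + k\<close>.\<close>

lemma exponent_tendsto:
  fixes k :: nat
  shows "(\<lambda>D. real (D\<^sup>2 + 3 * D + 4) /
      real (D\<^sup>2 + 3 * D + 4 + k * (2 * D\<^sup>2 + 2 * D - (D\<^sup>2 + 3 * D + 4))))
    \<longlonglongrightarrow> 1 / (real k + 1)"
proof -
  have "(\<lambda>D. (real D ^ 2 + 3 * real D + 4) /
      (real D ^ 2 + 3 * real D + 4 + real k * (real D ^ 2 - real D - 4))) \<longlonglongrightarrow> inverse (1 + real k)"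
    by real_asymp
  also have "inverse (1 + real k) = 1 / (real k + 1)"
    by (simp add: inverse_eq_divide add.commute)
  finally have "(\<lambda>D. (real D ^ 2 + 3 * real D + 4) /
      (real D ^ 2 + 3 * real D + 4 + real k * (real D ^ 2 - real D - 4))) \<longlonglongrightarrow> 1 / (real k + 1)" .
  moreover have "\<forall>\<^sub>F D in sequentially. (real D ^ 2 + 3 * real D + 4) /
      (real D ^ 2 + 3 * real D + 4 + real k * (real D ^ 2 - real D - 4)) =
    real (D\<^sup>2 + 3 * D + 4) /
      real (D\<^sup>2 + 3 * D + 4 + k * (2 * D\<^sup>2 + 2 * D - (D\<^sup>2 + 3 * D + 4)))"
    \<comment> \<open>From \<open>D = 3\<close> on, the subtraction of natural numbers is not
      truncated.\<close>
    using eventually_ge_at_top[of 3]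
  proof eventually_elim
    case (elim D)
    then have "3 * D \<le> D\<^sup>2"
      by (simp add: power2_eq_square)
    then have "real (2 * D\<^sup>2 + 2 * D - (D\<^sup>2 + 3 * D + 4)) = real D ^ 2 - real D - 4"
      using elim by (subst of_nat_diff) auto
    then show ?case
      by simp
  qed
  ultimately show ?thesis
    by (rule Lim_transform_eventually)
qed

theorem theorem1p1:
  fixes s t b l :: nat
  assumes "s \<ge> 2" and "t \<ge> 1" and "b \<ge> 3"
    and "l = (LEAST k. multicolor_ramsey k b > s)"
  shows "\<exists>\<epsilon> :: nat \<Rightarrow> real. \<epsilon> \<longlonglongrightarrow> 0 \<and>
    (\<forall>\<^sub>F n in sequentially.
       real (erdos_rogers s (replicate t b) n)
         \<le> real n powr (1 / (real_of_int \<lfloor>real t / real l\<rfloor> + 1) + \<epsilon> n))"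
proof (rule exists_vanishing_exponent)
  fix \<delta> :: real assume "\<delta> > 0"
  define k where "k = t div l"
  have floor: "real_of_int \<lfloor>real t / real l\<rfloor> = real k"
    by (simp add: floor_divide_of_nat_eq k_def)
  have "multicolor_ramsey l b > s"
    unfolding assms(4) using exists_multicolor_ramsey_greater[OF assms(3)] by (rule LeastI_ex)
  then have free: "K_free (replicate l b) {..<s} ([{..<s}]\<^bsup>2\<^esup>)"
    by (rule K_free_of_less_multicolor_ramsey)
  show "\<forall>\<^sub>F n in sequentially. real (erdos_rogers s (replicate t b) n)
      \<le> real n powr (1 / (real_of_int \<lfloor>real t / real l\<rfloor> + 1) + \<delta>)"
  proof (cases "k = 0")
    case True
    show ?thesis
      using eventually_ge_at_top[of 1]
    proof eventually_elim
      case (elim n)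
      have "real (erdos_rogers s (replicate t b) n) \<le> real n powr 1"
        using erdos_rogers_le_self[of b s t n] assms(1,3) by simp
      also have "\<dots> \<le> real n powr (1 + \<delta>)"
        using elim \<open>\<delta> > 0\<close> by (intro powr_mono) auto
      finally show ?case
        by (simp add: floor True)
    qed
  next
    case False
    \<comment> \<open>For fixed \<open>D\<close> the construction attains any exponent above
      \<open>p D / W D\<close>. This ratio tends to \<open>1 / (k + 1)\<close>, so some fixed
      \<open>D\<close> meets the given \<open>\<delta>\<close>.\<close>
    define p where "p D = D\<^sup>2 + 3 * D + 4" for D :: nat
    define W where "W D = p D + k * (2 * D\<^sup>2 + 2 * D - p D)" for D :: nat
    have "(\<lambda>D. real (p D) / real (W D)) \<longlonglongrightarrow> 1 / (real k + 1)"
      using exponent_tendsto unfolding W_def p_def .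
    then have "\<forall>\<^sub>F D in sequentially. real (p D) / real (W D) < 1 / (real k + 1) + \<delta>"
      using \<open>\<delta> > 0\<close> by (intro order_tendstoD(2)) auto
    then have "\<forall>\<^sub>F D in sequentially. D \<ge> 3 \<and> real (p D) / real (W D) < 1 / (real k + 1) + \<delta>"
      using eventually_ge_at_top[of 3] by eventually_elim simp
    then obtain D where D: "D \<ge> 3" "real (p D) / real (W D) < 1 / (real k + 1) + \<delta>"
      using eventually_happens'[OF sequentially_bot] by blast
    have "k * l \<le> t"
      by (simp add: k_def)
    then have "\<forall>\<^sub>F r in sequentially. \<forall>N. N \<le> r ^ W D \<longrightarrow> erdos_rogers s (replicate t b) N \<le> r ^ p D"
      unfolding W_def p_def using D(1) False assms(1,3) free by (intro erdos_rogers_power_bound) auto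
    moreover have "W D > 0"
      by (simp add: W_def p_def)
    ultimately show ?thesis
      unfolding floor using D(2) by (intro eventually_le_powr_of_power_bound[where W = "W D" and p = "p D"])
  qed
qed

end
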